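(* Let $r\ge1$ and let $\mathbf F\colon\mathcal M_{d\times d}\to\mathcal M_{d\times d}$ be the matrix inverse function $\mathbf F(\mathbf X)=\mathbf X^{-1}$ for all non-singular $\mathbf X$. Then the $r$th derivative of $\mathbf X^{-1}$ is $$\mathsf D^{\otimes r}(\operatorname{vec}\mathbf X^{-1})=(-1)^r\,r!\,(\mathbf I_{d^2}\otimes\boldsymbol{\mathcal S}_{d^2,r})(\mathbf I_d\otimes\mathbf K_{d,d^{2r}})(\operatorname{vec}\mathbf X^{-1})^{\otimes(r+1)}\in\mathbb R^{d^{2r+2}}.$$
   Context: Vectors are column vectors; $\mathcal M_{m\times n}$ is the set of real $m\times n$ matrices; $\mathbf I_n$ is the $n\times n$ identity; $\otimes$ is the Kronecker product, and $\boldsymbol A^{\otimes m}$ is the $m$-fold Kronecker power. $\operatorname{vec}$ stacks the columns of a matrix underneath each other. $\mathbf K_{m,n}\in\mathcal M_{mn\times mn}$ is the commutation matrix: $\mathbf K_{m,n}\operatorname{vec}\mathbf A=\operatorname{vec}(\mathbf A^\top)$ for all $\mathbf A\in\mathcal M_{m\times n}$. Vectorized derivatives: for a scalar function $f$ of $\boldsymbol x\in\mathbb R^n$, $\mathsf D^{\otimes r}f(\boldsymbol x)\in\mathbb R^{n^r}$ is the vector whose entry at position $1+\sum_{j=1}^r(i_j-1)n^{r-j}$ is $\frac{\partial^r f}{\partial x_{i_1}\cdots\partial x_{i_r}}(\boldsymbol x)$. For $\boldsymbol f=(f_1,\dots,f_p)$, $\mathsf D^{\otimes r}\boldsymbol f$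 is obtained by stacking $\mathsf D^{\otimes r}f_1,\dots,\mathsf D^{\otimes r}f_p$ underneath each other. For functions of a matrix variable $\mathbf X\in\mathcal M_{d\times d}$, derivatives are taken with respect to the vector variable $\operatorname{vec}\mathbf X\in\mathbb R^{d^2}$; a matrix-valued function $\mathbf F$ is differentiated through $\operatorname{vec}\mathbf F$. Symmetrizer matrix: $\boldsymbol{\mathcal S}_{n,r}$ is the $n^r\times n^r$ matrix determined by $r!\,\boldsymbol{\mathcal S}_{n,r}(\boldsymbol v_1\otimes\cdots\otimes\boldsymbol v_r)=\sum_{\sigma\in\mathcal P_r}\boldsymbol v_{\sigma(1)}\otimes\cdots\otimes\boldsymbol v_{\sigma(r)}$ for all $\boldsymbol v_1,\dots,\boldsymbol v_r\in\mathbb R^n$, where $\mathcal P_r$ is the set of all permutations of $\{1,\dots,r\}$. *)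

theory Defs
  imports
    "HOL-Analysis.Derivative"
    "HOL-Combinatorics.Permutations"
    "Jordan_Normal_Form.Matrix"
begin

unbundle no vec_syntax

text \<open>Indices of vectors and matrices are counted from 0 throughout.\<close>

section \<open>Kronecker products and vectorization\<close>

definition kron_mat :: "real mat \<Rightarrow> real mat \<Rightarrow> real mat" where
  "kron_mat A B = mat (dim_row A * dim_row B) (dim_col A * dim_col B)
     (\<lambda>(i, j). A $$ (i div dim_row B, j div dim_col B) * B $$ (i mod dim_row B, j mod dim_col B))"

definition kron_vec :: "real vec \<Rightarrow> real vec \<Rightarrow> real vec" where
  "kron_vec u v = vec (dim_vec u * dim_vec v) (\<lambda>i. u $ (i div dim_vec v) * v $ (i mod dim_vec v))"

primrec kron_list :: "real vec list \<Rightarrow> real vec" where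
  "kron_list [] = vec 1 (\<lambda>_. 1)"
| "kron_list (v # vs) = kron_vec v (kron_list vs)"

definition kron_pow :: "real vec \<Rightarrow> nat \<Rightarrow> real vec" where
  "kron_pow v m = kron_list (replicate m v)"

text \<open>Columns are stacked underneath each other: \<^term>\<open>unvectorize m n\<close> is the inverse of
  \<^term>\<open>vectorize\<close> on \<open>m \<times> n\<close> matrices.\<close>

definition vectorize :: "real mat \<Rightarrow> real vec" where
  "vectorize A = vec (dim_row A * dim_col A) (\<lambda>k. A $$ (k mod dim_row A, k div dim_row A))"

definition unvectorize :: "nat \<Rightarrow> nat \<Rightarrow> real vec \<Rightarrow> real mat" where
  "unvectorize m n v = mat m n (\<lambda>(i, j). v $ (j * m + i))"


section \<open>Multi-indices\<close>

text \<open>\<^term>\<open>multi_index n r\<close> is the inverse of the enumeration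
  \<open>(i\<^sub>1, \<dots>, i\<^sub>r) \<mapsto> (\<Sum>j = 1..r. i\<^sub>j * n ^ (r - j))\<close> of the \<open>r\<close>-tuples of numbers below \<open>n\<close>.\<close>

definition position :: "nat \<Rightarrow> nat list \<Rightarrow> nat" where
  "position n is = (\<Sum>j<length is. is ! j * n ^ (length is - Suc j))"

definition multi_index :: "nat \<Rightarrow> nat \<Rightarrow> nat \<Rightarrow> nat list" where
  "multi_index n r k = map (\<lambda>j. k div n ^ (r - Suc j) mod n) [0..<r]"


section \<open>Vectorized derivatives\<close>

definition partial_deriv :: "nat \<Rightarrow> (real vec \<Rightarrow> real) \<Rightarrow> real vec \<Rightarrow> real" where
  "partial_deriv i f x = deriv (\<lambda>t. f (x + t \<cdot>\<^sub>v unit_vec (dim_vec x) i)) 0"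

primrec iter_partial :: "nat list \<Rightarrow> (real vec \<Rightarrow> real) \<Rightarrow> real vec \<Rightarrow> real" where
  "iter_partial [] f = f"
| "iter_partial (i # is) f = partial_deriv i (iter_partial is f)"

definition vderiv_scalar :: "nat \<Rightarrow> (real vec \<Rightarrow> real) \<Rightarrow> real vec \<Rightarrow> real vec" where
  "vderiv_scalar r f x =
     vec (dim_vec x ^ r) (\<lambda>k. iter_partial (multi_index (dim_vec x) r k) f x)"

text \<open>The blocks \<^term>\<open>vderiv_scalar r (\<lambda>y. f y $ l) x\<close> for \<open>l = 0, 1, \<dots>\<close>, each of
  length \<^term>\<open>dim_vec x ^ r\<close>, are stacked underneath each other.\<close>

definition vderiv :: "nat \<Rightarrow> (real vec \<Rightarrow> real vec) \<Rightarrow> real vec \<Rightarrow> real vec" where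
  "vderiv r f x = (let N = dim_vec x ^ r in
     vec (dim_vec (f x) * N) (\<lambda>k. vderiv_scalar r (\<lambda>y. f y $ (k div N)) x $ (k mod N)))"

definition mat_vderiv :: "nat \<Rightarrow> (real mat \<Rightarrow> real mat) \<Rightarrow> real mat \<Rightarrow> real vec" where
  "mat_vderiv r F X =
     vderiv r (\<lambda>x. vectorize (F (unvectorize (dim_row X) (dim_col X) x))) (vectorize X)"

text \<open>As \<^const>\<open>deriv\<close> is a total operator, existence of the partial derivatives is a separate
  notion. It is meant for open \<open>S\<close>: then the values of \<open>f\<close> outside \<open>S\<close> are irrelevant, and all
  partial derivatives of order up to \<open>r\<close> of all components of \<open>f\<close> exist on \<open>S\<close>.\<close>

definition partially_differentiable_on ::
    "nat \<Rightarrow> (real vec \<Rightarrow> real vec) \<Rightarrow> real vec set \<Rightarrow> bool" where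
  "partially_differentiable_on r f S \<longleftrightarrow>
     (\<forall>x\<in>S. \<forall>l<dim_vec (f x). \<forall>is i. length is < r \<and> set (i # is) \<subseteq> {..<dim_vec x} \<longrightarrow>
        (\<lambda>t. iter_partial is (\<lambda>y. f y $ l) (x + t \<cdot>\<^sub>v unit_vec (dim_vec x) i))
          field_differentiable at 0)"


section \<open>Commutation matrix and symmetrizer matrix\<close>

text \<open>Both matrices are specified by their defining property; existence and uniqueness are
  shown below.\<close>

definition comm_mat :: "nat \<Rightarrow> nat \<Rightarrow> real mat" where
  "comm_mat m n = (THE K. K \<in> carrier_mat (m * n) (m * n) \<and>
     (\<forall>A \<in> carrier_mat m n. K *\<^sub>v vectorize A = vectorize (transpose_mat A)))"

definition symmetrizer :: "nat \<Rightarrow> nat \<Rightarrow> real mat" where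
  "symmetrizer n r = (THE S. S \<in> carrier_mat (n ^ r) (n ^ r) \<and>
     (\<forall>vs. length vs = r \<and> set vs \<subseteq> carrier_vec n \<longrightarrow>
        fact r \<cdot>\<^sub>v (S *\<^sub>v kron_list vs) =
        finsum_vec TYPE(real) (n ^ r) (\<lambda>\<sigma>. kron_list (permute_list \<sigma> vs)) {\<sigma>. \<sigma> permutes {..<r}}))"


section \<open>Well-definedness\<close>

lemma vectorize_dim [simp]: "dim_vec (vectorize A) = dim_row A * dim_col A"
  by (simp add: vectorize_def)

lemma unvectorize_carrier [simp]: "unvectorize m n v \<in> carrier_mat m n"
  by (simp add: unvectorize_def)

lemma index_bound: "i < m \<Longrightarrow> j < n \<Longrightarrow> j * m + i < m * (n::nat)"
proof -
  assume "i < m" "j < n"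
  then have "j * m + i < Suc j * m" by simp
  also have "\<dots> \<le> n * m" using \<open>j < n\<close> by (intro mult_le_mono1) simp
  finally show ?thesis by (simp add: mult.commute)
qed

lemma unvectorize_vectorize:
  assumes "A \<in> carrier_mat m n"
  shows "unvectorize m n (vectorize A) = A"
  using assms by (intro eq_matI) (auto simp: vectorize_def unvectorize_def index_bound)

lemma div_bound: "k < m * (n::nat) \<Longrightarrow> k div m < n"
  by (simp add: less_mult_imp_div_less mult.commute)

lemma mod_bound: "k < m * (n::nat) \<Longrightarrow> k mod m < m"
  by (cases "m = 0") auto

lemma vectorize_unvectorize:
  assumes "v \<in> carrier_vec (m * n)"
  shows "vectorize (unvectorize m n v) = v"
  using assms by (intro eq_vecI) (auto simp: vectorize_def unvectorize_def div_bound mod_bound)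

lemma mult_unit_vec:
  assumes "(A::real mat) \<in> carrier_mat m n" "j < n"
  shows "A *\<^sub>v unit_vec n j = col A j"
  using assms by (intro eq_vecI) auto

lemma mat_eq_by_unit_vecs:
  assumes "(A::real mat) \<in> carrier_mat m n" "B \<in> carrier_mat m n"
    and "\<And>j. j < n \<Longrightarrow> A *\<^sub>v unit_vec n j = B *\<^sub>v unit_vec n j"
  shows "A = B"
proof (rule mat_col_eqI)
  fix j assume "j < dim_col B"
  with assms show "col A j = col B j"
    using mult_unit_vec[of A m n j] mult_unit_vec[of B m n j] by auto
qed (use assms in auto)

lemma comm_mat_ex1:
  "\<exists>!K. K \<in> carrier_mat (m * n) (m * n) \<and>
     (\<forall>A \<in> carrier_mat m n. K *\<^sub>v vectorize A = vectorize (transpose_mat A))"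
proof (rule ex_ex1I)
  define K :: "real mat" where
    "K = mat (m * n) (m * n) (\<lambda>(k, l). of_bool (l = (k mod n) * m + k div n))"
  have "K *\<^sub>v vectorize A = vectorize (transpose_mat A)" if A: "A \<in> carrier_mat m n" for A
  proof (rule eq_vecI)
    fix k assume "k < dim_vec (vectorize (transpose_mat A))"
    with A have k: "k < n * m" by simp
    have b: "k div n < m" "k mod n < n" using div_bound[OF k] mod_bound[OF k] .
    have l: "(k mod n) * m + k div n < m * n" using b by (rule index_bound)
    have "(K *\<^sub>v vectorize A) $ k =
        (\<Sum>l<m * n. of_bool (l = (k mod n) * m + k div n) * vectorize A $ l)"
      using A k by (auto simp: K_def scalar_prod_def atLeast0LessThan mult.commute intro!: sum.cong)
    also have "\<dots> = (\<Sum>l<m * n. if l = (k mod n) * m + k div n then vectorize A $ l else 0)"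
      by (intro sum.cong) auto
    also have "\<dots> = vectorize A $ ((k mod n) * m + k div n)"
      using l by simp
    also have "\<dots> = vectorize (transpose_mat A) $ k"
      using A b k l by (auto simp: vectorize_def mult.commute)
    finally show "(K *\<^sub>v vectorize A) $ k = vectorize (transpose_mat A) $ k" .
  qed (use A in \<open>auto simp: K_def\<close>)
  then show "\<exists>K. K \<in> carrier_mat (m * n) (m * n) \<and>
     (\<forall>A \<in> carrier_mat m n. K *\<^sub>v vectorize A = vectorize (transpose_mat A))"
    by (intro exI[of _ K]) (auto simp: K_def)
next
  fix K L :: "real mat"
  assume K: "K \<in> carrier_mat (m * n) (m * n) \<and>
      (\<forall>A \<in> carrier_mat m n. K *\<^sub>v vectorize A = vectorize (transpose_mat A))"
    and L: "L \<in> carrier_mat (m * n) (m * n) \<and>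
      (\<forall>A \<in> carrier_mat m n. L *\<^sub>v vectorize A = vectorize (transpose_mat A))"
  show "K = L"
  proof (rule mat_eq_by_unit_vecs)
    fix j assume "j < m * n"
    have "K *\<^sub>v vectorize (unvectorize m n v) = L *\<^sub>v vectorize (unvectorize m n v)" for v
      using K L by simp
    then show "K *\<^sub>v unit_vec (m * n) j = L *\<^sub>v unit_vec (m * n) j"
      by (metis unit_vec_carrier vectorize_unvectorize)
  qed (use K L in auto)
qed

lemma length_multi_index [simp]: "length (multi_index n r k) = r"
  by (simp add: multi_index_def)

lemma multi_index_Suc: "multi_index n (Suc r) k = (k div n ^ r mod n) # multi_index n r k"
  by (simp add: multi_index_def upt_conv_Cons map_Suc_upt[symmetric] del: upt_Suc)

lemma position_Nil [simp]: "position n [] = 0"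
  by (simp add: position_def)

lemma position_Cons: "position n (i # is) = i * n ^ length is + position n is"
  by (simp add: position_def sum.lessThan_Suc_shift del: sum.lessThan_Suc)

lemma position_less:
  assumes "set is \<subseteq> {..<n}"
  shows "position n is < n ^ length is"
  using assms
proof (induction "is")
  case (Cons i "is")
  then show ?case
    using index_bound[of "position n is" "n ^ length is" i n] by (simp add: position_Cons mult.commute)
qed simp

lemma multi_index_add: "multi_index n r (a * n ^ r + k) = multi_index n r k"
proof (cases "n = 0")
  case False
  have "(a * n ^ r + k) div n ^ (r - Suc j) mod n = k div n ^ (r - Suc j) mod n" if "j < r" for j
  proof -
    have "n ^ r = n ^ (r - Suc j) * (n ^ j * n)"
      using that by (simp only: power_add[symmetric] power_Suc2[symmetric]) simp
    then have "a * n ^ r + k = k + (a * n ^ j * n) * n ^ (r - Suc j)"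
      by (simp add: algebra_simps)
    then have "(a * n ^ r + k) div n ^ (r - Suc j) = k div n ^ (r - Suc j) + (a * n ^ j) * n"
      using False by (simp only: div_mult_self1 power_eq_0_iff) simp
    then show ?thesis by (simp only: mod_mult_self1)
  qed
  then show ?thesis by (auto simp: multi_index_def)
next
  case True
  then show ?thesis by (cases r) (auto simp: multi_index_def)
qed

lemma multi_index_position:
  assumes "set is \<subseteq> {..<n}"
  shows "multi_index n (length is) (position n is) = is"
  using assms
proof (induction "is")
  case Nil
  then show ?case by (simp add: multi_index_def)
next
  case (Cons i "is")
  then have "position n is < n ^ length is" by (intro position_less) auto
  with Cons show ?case by (simp add: multi_index_Suc position_Cons multi_index_add)
qed

lemma position_multi_index_mod: "position n (multi_index n r k) = k mod n ^ r"
proof (induction r)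
  case 0
  then show ?case by (simp add: multi_index_def)
next
  case (Suc r)
  then show ?case
    by (simp add: multi_index_Suc position_Cons mod_mult2_eq[of k "n ^ r" n] mult.commute[of n] mult.commute[of "n ^ r" "_ mod _"])
qed

lemma position_multi_index: "k < n ^ r \<Longrightarrow> position n (multi_index n r k) = k"
  by (simp add: position_multi_index_mod)

lemma set_multi_index: "k < n ^ r \<Longrightarrow> set (multi_index n r k) \<subseteq> {..<n}"
  by (cases "n = 0"; cases r) (auto simp: multi_index_def)

lemma vderiv_scalar_position:
  assumes "set is \<subseteq> {..<dim_vec x}"
  shows "vderiv_scalar (length is) f x $ position (dim_vec x) is = iter_partial is f x"
  using assms by (simp add: vderiv_scalar_def position_less multi_index_position)

lemma dim_kron_list:
  assumes "set vs \<subseteq> carrier_vec n"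
  shows "dim_vec (kron_list vs) = n ^ length vs"
  using assms by (induction vs) (auto simp: kron_vec_def)

lemma kron_list_index:
  assumes "set vs \<subseteq> carrier_vec n" "length vs = r" "k < n ^ r"
  shows "kron_list vs $ k = (\<Prod>j<r. vs ! j $ (multi_index n r k ! j))"
  using assms
proof (induction vs arbitrary: r k)
  case Nil
  then show ?case by simp
next
  case (Cons v vs)
  define s where "s = length vs"
  have r: "r = Suc s" using Cons.prems by (simp add: s_def)
  have k: "k < n ^ s * n" using Cons.prems r by (simp add: mult.commute)
  have d: "dim_vec (kron_list vs) = n ^ s" using Cons.prems by (simp add: dim_kron_list s_def)
  have v: "dim_vec v = n" using Cons.prems by simp
  have "k div n ^ s < n" "k mod n ^ s < n ^ s" using div_bound[OF k] mod_bound[OF k] .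
  have mi: "multi_index n s (k mod n ^ s) = multi_index n s k"
    using multi_index_add[of n s "k div n ^ s" "k mod n ^ s"] by (simp only: div_mult_mod_eq)
  have "kron_list (v # vs) $ k = v $ (k div n ^ s) * kron_list vs $ (k mod n ^ s)"
    using k by (simp add: kron_vec_def d v mult.commute)
  also have "kron_list vs $ (k mod n ^ s) = (\<Prod>j<s. vs ! j $ (multi_index n s k ! j))"
    using Cons.IH[of s "k mod n ^ s"] Cons.prems \<open>k mod n ^ s < n ^ s\<close> mi by (simp add: s_def)
  also have "v $ (k div n ^ s) * \<dots> = (\<Prod>j<r. (v # vs) ! j $ (multi_index n r k ! j))"
    using \<open>k div n ^ s < n\<close>
    by (simp add: r multi_index_Suc prod.lessThan_Suc_shift del: prod.lessThan_Suc)
  finally show ?case .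
qed

lemma set_permute_list_subset:
  assumes "\<sigma> permutes {..<length vs}"
  shows "set (permute_list \<sigma> vs) = set vs"
  using assms by simp

lemma kron_list_unit_vecs:
  assumes "l < n ^ r"
  shows "kron_list (map (unit_vec n) (multi_index n r l)) = unit_vec (n ^ r) l"
proof (rule eq_vecI)
  have u: "set (map (unit_vec n) (multi_index n r l)) \<subseteq> (carrier_vec n :: real vec set)" by auto
  show "dim_vec (kron_list (map (unit_vec n) (multi_index n r l))) = dim_vec (unit_vec (n ^ r) l)"
    using dim_kron_list[OF u] by simp
  fix k assume "k < dim_vec (unit_vec (n ^ r) l)"
  then have k: "k < n ^ r" by simp
  have el: "multi_index n r l ! j < n" "multi_index n r k ! j < n" if "j < r" for j
    using set_multi_index[OF assms] set_multi_index[OF k] that nth_mem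
    by (metis length_multi_index lessThan_iff subsetD)+
  have "kron_list (map (unit_vec n) (multi_index n r l)) $ k =
      (\<Prod>j<r. of_bool (multi_index n r l ! j = multi_index n r k ! j))"
    using el by (subst kron_list_index[OF u _ k]) (auto intro!: prod.cong)
  also have "\<dots> = of_bool (multi_index n r l = multi_index n r k)"
    by (auto simp: list_eq_iff_nth_eq)
  also have "multi_index n r l = multi_index n r k \<longleftrightarrow> l = k"
    using position_multi_index assms k by metis
  finally show "kron_list (map (unit_vec n) (multi_index n r l)) $ k = unit_vec (n ^ r) l $ k"
    using k assms by auto
qed

lemma symmetrizer_ex1:
  "\<exists>!S. S \<in> carrier_mat (n ^ r) (n ^ r) \<and>
     (\<forall>vs. length vs = r \<and> set vs \<subseteq> carrier_vec n \<longrightarrow>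
        fact r \<cdot>\<^sub>v (S *\<^sub>v kron_list vs) =
        finsum_vec TYPE(real) (n ^ r) (\<lambda>\<sigma>. kron_list (permute_list \<sigma> vs)) {\<sigma>. \<sigma> permutes {..<r}})"
proof (rule ex_ex1I)
  let ?P = "{\<sigma>. \<sigma> permutes {..<r}}"
  let ?mi = "multi_index n r"
  define S :: "real mat" where
    "S = mat (n ^ r) (n ^ r) (\<lambda>(k, l). (\<Sum>\<sigma>\<in>?P. of_bool (permute_list \<sigma> (?mi l) = ?mi k)) / fact r)"
  have fin: "finite ?P" by (simp add: finite_permutations)
  have "fact r \<cdot>\<^sub>v (S *\<^sub>v kron_list vs) =
      finsum_vec TYPE(real) (n ^ r) (\<lambda>\<sigma>. kron_list (permute_list \<sigma> vs)) ?P"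
    if vs: "length vs = r" "set vs \<subseteq> carrier_vec n" for vs
  proof -
    have c: "(\<lambda>\<sigma>. kron_list (permute_list \<sigma> vs)) \<in> ?P \<rightarrow> carrier_vec (n ^ r)"
    proof
      fix \<sigma> assume "\<sigma> \<in> ?P"
      then have "set (permute_list \<sigma> vs) \<subseteq> carrier_vec n" using vs by simp
      then show "kron_list (permute_list \<sigma> vs) \<in> carrier_vec (n ^ r)"
        using dim_kron_list vs by (metis carrier_vec_dim_vec length_permute_list)
    qed
    have "finsum_vec TYPE(real) (n ^ r) (\<lambda>\<sigma>. kron_list (permute_list \<sigma> vs)) ?P \<in> carrier_vec (n ^ r)"
      using finsum_vec_closed[OF c] .
    moreover have "fact r * (S *\<^sub>v kron_list vs) $ k =
        finsum_vec TYPE(real) (n ^ r) (\<lambda>\<sigma>. kron_list (permute_list \<sigma> vs)) ?P $ k"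
      if k: "k < n ^ r" for k
    proof -
      have "fact r * (S *\<^sub>v kron_list vs) $ k =
          (\<Sum>l<n ^ r. (\<Sum>\<sigma>\<in>?P. of_bool (permute_list \<sigma> (?mi l) = ?mi k)) * kron_list vs $ l)"
        using k dim_kron_list[OF vs(2)] vs(1)
        by (auto simp: S_def scalar_prod_def atLeast0LessThan sum_distrib_left intro!: sum.cong)
      also have "\<dots> = (\<Sum>\<sigma>\<in>?P. \<Sum>l<n ^ r. of_bool (permute_list \<sigma> (?mi l) = ?mi k) * kron_list vs $ l)"
        by (subst sum.swap) (simp add: sum_distrib_right)
      also have "\<dots> = (\<Sum>\<sigma>\<in>?P. kron_list (permute_list \<sigma> vs) $ k)"
      proof (rule sum.cong[OF refl])
        fix \<sigma> assume "\<sigma> \<in> ?P"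
        then have \<sigma>: "\<sigma> permutes {..<r}" by simp
        then have \<tau>: "Hilbert_Choice.inv \<sigma> permutes {..<r}" by (rule permutes_inv)
        define "is" where "is = permute_list (Hilbert_Choice.inv \<sigma>) (?mi k)"
        have sis: "set is \<subseteq> {..<n}" "length is = r"
          using \<tau> set_multi_index[OF k] by (auto simp: is_def)
        define m where "m = position n is"
        have m: "m < n ^ r" using position_less[OF sis(1)] sis(2) by (simp add: m_def)
        have mim: "?mi m = is" using multi_index_position[OF sis(1)] sis(2) by (simp add: m_def)
        have nth: "is ! j = ?mi k ! (Hilbert_Choice.inv \<sigma> j)" if "j < r" for j
          using that \<tau> by (simp add: is_def permute_list_nth)
        have "permute_list \<sigma> (?mi l) = ?mi k \<longleftrightarrow> l = m" if l: "l < n ^ r" for l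
        proof
          assume *: "permute_list \<sigma> (?mi l) = ?mi k"
          have "?mi l = is"
          proof (rule nth_equalityI)
            fix j assume "j < length (?mi l)"
            then have j: "j < r" by simp
            then have "Hilbert_Choice.inv \<sigma> j < r" using \<tau> permutes_in_image by fastforce
            then have "?mi k ! (Hilbert_Choice.inv \<sigma> j) = ?mi l ! (\<sigma> (Hilbert_Choice.inv \<sigma> j))"
              unfolding *[symmetric] using \<sigma> by (simp add: permute_list_nth)
            then show "?mi l ! j = is ! j"
              using nth[OF j] permutes_inverses(1)[OF \<sigma>] by simp
          qed (simp add: sis)
          then show "l = m" using position_multi_index[OF l] by (simp add: m_def)
        next
          assume "l = m"
          have "permute_list \<sigma> is = ?mi k"
          proof (rule nth_equalityI)
            fix j assume "j < length (permute_list \<sigma> is)"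
            then have j: "j < r" by (simp add: sis)
            then have "\<sigma> j < r" using \<sigma> permutes_in_image by fastforce
            then show "permute_list \<sigma> is ! j = ?mi k ! j"
              using j \<sigma> sis nth permutes_inverses(2)[OF \<sigma>] by (simp add: permute_list_nth)
          qed (simp add: sis)
          with \<open>l = m\<close> show "permute_list \<sigma> (?mi l) = ?mi k" by (simp add: mim)
        qed
        then have "(\<Sum>l<n ^ r. of_bool (permute_list \<sigma> (?mi l) = ?mi k) * kron_list vs $ l) =
            (\<Sum>l<n ^ r. if l = m then kron_list vs $ l else 0)"
          by (intro sum.cong) auto
        also have "\<dots> = kron_list vs $ m" using m by simp
        also have "\<dots> = (\<Prod>j<r. vs ! j $ (is ! j))"
          using kron_list_index[OF vs(2,1) m] by (simp add: mim)
        also have "\<dots> = (\<Prod>j<r. vs ! (\<sigma> j) $ (is ! (\<sigma> j)))"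
          by (rule prod.permute[OF \<sigma>, unfolded comp_def])
        also have "\<dots> = (\<Prod>j<r. permute_list \<sigma> vs ! j $ (?mi k ! j))"
        proof (rule prod.cong[OF refl])
          fix j assume "j \<in> {..<r}"
          then have j: "j < r" by simp
          then have "\<sigma> j < r" using \<sigma> permutes_in_image by fastforce
          then show "vs ! (\<sigma> j) $ (is ! (\<sigma> j)) = permute_list \<sigma> vs ! j $ (?mi k ! j)"
            using j \<sigma> vs nth permutes_inverses(2)[OF \<sigma>] by (simp add: permute_list_nth)
        qed
        also have "\<dots> = kron_list (permute_list \<sigma> vs) $ k"
          using kron_list_index[of "permute_list \<sigma> vs" n r k] vs \<sigma> k by simp
        finally show "(\<Sum>l<n ^ r. of_bool (permute_list \<sigma> (?mi l) = ?mi k) * kron_list vs $ l) =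
            kron_list (permute_list \<sigma> vs) $ k" .
      qed
      also have "\<dots> = finsum_vec TYPE(real) (n ^ r) (\<lambda>\<sigma>. kron_list (permute_list \<sigma> vs)) ?P $ k"
        using index_finsum_vec[OF fin k c] by simp
      finally show ?thesis .
    qed
    moreover have "dim_vec (S *\<^sub>v kron_list vs) = n ^ r" by (simp add: S_def)
    ultimately show ?thesis by (intro eq_vecI) auto
  qed
  then show "\<exists>S. S \<in> carrier_mat (n ^ r) (n ^ r) \<and>
     (\<forall>vs. length vs = r \<and> set vs \<subseteq> carrier_vec n \<longrightarrow>
        fact r \<cdot>\<^sub>v (S *\<^sub>v kron_list vs) =
        finsum_vec TYPE(real) (n ^ r) (\<lambda>\<sigma>. kron_list (permute_list \<sigma> vs)) ?P)"
    by (intro exI[of _ S]) (auto simp: S_def)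
next
  fix S T :: "real mat"
  let ?R = "\<lambda>vs. finsum_vec TYPE(real) (n ^ r) (\<lambda>\<sigma>. kron_list (permute_list \<sigma> vs))
    {\<sigma>. \<sigma> permutes {..<r}}"
  assume S: "S \<in> carrier_mat (n ^ r) (n ^ r) \<and> (\<forall>vs. length vs = r \<and> set vs \<subseteq> carrier_vec n \<longrightarrow>
      fact r \<cdot>\<^sub>v (S *\<^sub>v kron_list vs) = ?R vs)"
    and T: "T \<in> carrier_mat (n ^ r) (n ^ r) \<and> (\<forall>vs. length vs = r \<and> set vs \<subseteq> carrier_vec n \<longrightarrow>
      fact r \<cdot>\<^sub>v (T *\<^sub>v kron_list vs) = ?R vs)"
  show "S = T"
  proof (rule mat_eq_by_unit_vecs)
    fix l assume l: "l < n ^ r"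
    have u: "length (map (unit_vec n) (multi_index n r l)) = r"
        "set (map (unit_vec n) (multi_index n r l)) \<subseteq> (carrier_vec n :: real vec set)"
      by auto
    have "fact r \<cdot>\<^sub>v (S *\<^sub>v kron_list (map (unit_vec n) (multi_index n r l))) =
        (fact r :: real) \<cdot>\<^sub>v (T *\<^sub>v kron_list (map (unit_vec n) (multi_index n r l)))"
      using S T u by metis
    then have e: "(fact r :: real) \<cdot>\<^sub>v (S *\<^sub>v unit_vec (n ^ r) l) = fact r \<cdot>\<^sub>v (T *\<^sub>v unit_vec (n ^ r) l)"
      by (simp only: kron_list_unit_vecs[OF l])
    have "inverse (fact r :: real) \<cdot>\<^sub>v (fact r \<cdot>\<^sub>v v) = v" for v :: "real vec"
      by (simp add: smult_smult_assoc)
    then show "S *\<^sub>v unit_vec (n ^ r) l = T *\<^sub>v unit_vec (n ^ r) l" using e by metis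
  qed (use S T in auto)
qed

end

theory Submission
  imports Defs "HOL-Combinatorics.Multiset_Permutations" "Jordan_Normal_Form.Determinant"
begin

text \<open>Write \<open>Y = X\<^sup>-\<^sup>1\<close>. Moving \<open>X\<close> along the matrix unit \<open>E\<^sub>p\<^sub>q\<close> changes \<open>Y\<close> to first order by
  \<open>- Y E\<^sub>p\<^sub>q Y\<close>, so the entry \<open>Y\<^sub>a\<^sub>b\<close> has the partial derivative \<open>- Y\<^sub>a\<^sub>p Y\<^sub>q\<^sub>b\<close>. By the product
  rule, each further differentiation in the direction \<open>E\<^sub>p\<^sub>q\<close> breaks one factor of such a product
  into two and inserts the new direction there. After \<open>r\<close> steps this has produced all orders of the
  \<open>r\<close> directions, each of them once: the \<open>r\<close>-th partial derivative of \<open>Y\<^sub>a\<^sub>b\<close> is \<open>(- 1)\<^sup>r\<close> times the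
  sum, over all orderings of the directions, of the products
  \<open>Y(q\<^sub>1, b) * Y(q\<^sub>2, p\<^sub>1) * \<dots> * Y(a, p\<^sub>r)\<close> (lemma \<open>iter_partial_entry_nth\<close>).

  The right-hand side of the formula contains the same sum. The entries of the \<open>(r + 1)\<close>-fold
  Kronecker power of \<open>vec Y\<close> are all products of \<open>r + 1\<close> entries of \<open>Y\<close>, indexed by
  \<open>(b, q\<^sub>1, p\<^sub>1, \<dots>, q\<^sub>r, p\<^sub>r, a)\<close> when columns precede rows. The index of a partial derivative
  lists \<open>(b, a)\<close> before all the directions \<open>(q\<^sub>j, p\<^sub>j)\<close>, and the commutation matrix moves \<open>a\<close> from the
  end to its place behind \<open>b\<close>. The symmetrizer then averages over the orderings of the directions
  (lemma \<open>symmetrized_commuted_kron_pow\<close>), and \<open>r!\<close> turns the average into the sum.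

  All the differentiation reduces to one explicit formula: along a matrix unit the inverse is a
  rational function of the parameter, by the Sherman-Morrison identity (lemma
  \<open>rank_one_update_inverse\<close>). It shows at the same time that the matrices near \<open>X\<close> on this line
  are invertible, so that the formula for lower-order derivatives holds along the line and can be
  differentiated again.\<close>

section \<open>Sums over orderings\<close>

text \<open>Removing \<open>a\<close> from an ordering of \<open>insert a A\<close> leaves an ordering of \<open>A\<close>, and the place where \<open>a\<close>
  stood is the only information lost. This is the combinatorial counterpart of one application of
  the product rule.\<close>

lemma sum_permutations_insert:
  fixes g :: "'a list \<Rightarrow> 'b::comm_monoid_add"
  assumes "finite A" "a \<notin> A"
  shows "(\<Sum>zs\<in>permutations_of_set (insert a A). g zs) =
    (\<Sum>ys\<in>permutations_of_set A. \<Sum>m\<le>card A. g (take m ys @ a # drop m ys))"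
proof -
  let ?ins = "\<lambda>(ys, m). take m ys @ a # drop m ys"
  let ?D = "permutations_of_set A \<times> {..card A}"
  have "bij_betw ?ins ?D (permutations_of_set (insert a A))"
  proof (rule bij_betwI')
    fix x y assume "x \<in> ?D" "y \<in> ?D"
    then obtain ys m zs n where [simp]: "x = (ys, m)" "y = (zs, n)"
      and *: "ys \<in> permutations_of_set A" "m \<le> card A" "zs \<in> permutations_of_set A" "n \<le> card A"
      by auto
    show "?ins x = ?ins y \<longleftrightarrow> x = y"
    proof
      assume e: "?ins x = ?ins y"
      have "a \<notin> set ys" "a \<notin> set zs"
        using * assms(2) by (auto simp: permutations_of_set_def)
      then have n: "a \<notin> set (take m ys)" "a \<notin> set (drop m ys)" "a \<notin> set (take n zs)" "a \<notin> set (drop n zs)"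
        by (meson in_set_takeD in_set_dropD)+
      have "take m ys = take n zs \<and> drop m ys = drop n zs"
        using e n by (simp add: append_Cons_eq_iff)
      moreover from this have "ys = zs" by (metis append_take_drop_id)
      moreover have "length (take m ys) = m" "length (take n zs) = n"
        using * by (auto simp: length_finite_permutations_of_set)
      ultimately show "x = y" by simp
    qed simp
  next
    fix x assume "x \<in> ?D"
    then obtain ys m where [simp]: "x = (ys, m)"
      and *: "ys \<in> permutations_of_set A" "m \<le> card A"
      by auto
    have s: "set (take m ys) \<union> set (drop m ys) = A"
      using * by (metis append_take_drop_id permutations_of_setD(1) set_append)
    have "distinct (take m ys @ drop m ys)"
      using * by (simp only: append_take_drop_id permutations_of_setD)
    then show "?ins x \<in> permutations_of_set (insert a A)"
      using s assms(2) by (intro permutations_of_setI) (simp_all del: append_take_drop_id, blast)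
  next
    fix zs assume zs: "zs \<in> permutations_of_set (insert a A)"
    then have "a \<in> set zs" by (simp add: permutations_of_setD)
    then obtain us vs where e: "zs = us @ a # vs" by (meson split_list)
    have "us @ vs \<in> permutations_of_set A"
      using zs assms(2) unfolding e permutations_of_set_def by auto
    moreover from this have "length us \<le> card A"
      using length_finite_permutations_of_set by fastforce
    ultimately show "\<exists>x\<in>?D. zs = ?ins x"
      by (intro bexI[of _ "(us @ vs, length us)"]) (auto simp: e)
  qed
  from sum.reindex_bij_betw[OF this, of g] show ?thesis
    by (simp add: sum.cartesian_product case_prod_unfold)
qed

text \<open>The symmetrizer is given by permutations as functions, while the induction over derivatives produces
  orderings as lists.\<close>

lemma sum_permutes_eq_sum_permutations_of_set:
  "(\<Sum>\<sigma> | \<sigma> permutes {..<r}. g (map \<sigma> [0..<r])) = (\<Sum>zs\<in>permutations_of_set {..<r}. g zs)"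
proof -
  have "bij_betw (\<lambda>\<sigma>. map \<sigma> [0..<r]) {\<sigma>. \<sigma> permutes {..<r}} (permutations_of_set {..<r})"
  proof (rule bij_betwI')
    fix \<sigma> \<tau> assume "\<sigma> \<in> {\<sigma>. \<sigma> permutes {..<r}}" "\<tau> \<in> {\<sigma>. \<sigma> permutes {..<r}}"
    then have p: "\<sigma> permutes {..<r}" "\<tau> permutes {..<r}" by auto
    show "map \<sigma> [0..<r] = map \<tau> [0..<r] \<longleftrightarrow> \<sigma> = \<tau>"
    proof
      assume e: "map \<sigma> [0..<r] = map \<tau> [0..<r]"
      show "\<sigma> = \<tau>"
      proof
        fix j show "\<sigma> j = \<tau> j"
          using e permutes_not_in[OF p(1), of j] permutes_not_in[OF p(2), of j] by (cases "j < r") auto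
      qed
    qed simp
  next
    fix \<sigma> assume "\<sigma> \<in> {\<sigma>. \<sigma> permutes {..<r}}"
    then have "\<sigma> permutes {..<r}" by simp
    then show "map \<sigma> [0..<r] \<in> permutations_of_set {..<r}"
      by (intro permutations_of_setI)
         (simp_all add: distinct_map permutes_inj_on permutes_image atLeast0LessThan)
  next
    fix zs assume zs: "zs \<in> permutations_of_set {..<r}"
    have l: "length zs = r" using zs by (simp add: length_finite_permutations_of_set)
    define \<sigma> where "\<sigma> j = (if j < r then zs ! j else j)" for j
    have "bij_betw ((!) zs) {..<r} {..<r}"
      using permutations_of_setD[OF zs] l by (intro bij_betw_nth) auto
    then have "bij_betw \<sigma> {..<r} {..<r}"
      by (subst bij_betw_cong[of _ _ "(!) zs"]) (auto simp: \<sigma>_def)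
    then have "\<sigma> permutes {..<r}"
      by (rule bij_imp_permutes) (simp add: \<sigma>_def)
    moreover have "zs = map \<sigma> [0..<r]"
      using l by (intro nth_equalityI) (auto simp: \<sigma>_def)
    ultimately show "\<exists>\<sigma>\<in>{\<sigma>. \<sigma> permutes {..<r}}. zs = map \<sigma> [0..<r]" by blast
  qed
  then show ?thesis by (rule sum.reindex_bij_betw)
qed

section \<open>Entries of the Kronecker power and of the matrices applied to it\<close>

text \<open>A number \<open>j < d * d\<close> encodes the position of a \<open>d \<times> d\<close> matrix in row \<open>j mod d\<close> and column
  \<open>j div d\<close>, as in the vectorization. The product below is the entry in row \<open>a\<close> and column \<open>b\<close> of
  \<open>Y E Y E' \<dots> Y\<close>, where the \<open>E\<close>s are the matrix units at the positions in the list, the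
  head of the list being the rightmost one.\<close>

primrec chain_product :: "nat \<Rightarrow> real mat \<Rightarrow> nat list \<Rightarrow> nat \<Rightarrow> nat \<Rightarrow> real" where
  "chain_product d Y [] b a = Y $$ (a, b)"
| "chain_product d Y (j # js) b a = Y $$ (j div d, b) * chain_product d Y js (j mod d) a"

lemma comm_mat_carrier: "comm_mat m n \<in> carrier_mat (m * n) (m * n)"
  and comm_mat_vectorize:
    "A \<in> carrier_mat m n \<Longrightarrow> comm_mat m n *\<^sub>v vectorize A = vectorize (transpose_mat A)"
  using theI'[OF comm_mat_ex1[of m n], folded comm_mat_def] by auto

lemma index_comm_mat_mult:
  assumes "w \<in> carrier_vec (m * n)" "a < m" "k < n"
  shows "(comm_mat m n *\<^sub>v w) $ (a * n + k) = w $ (k * m + a)"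
proof -
  have b: "a * n + k < n * m" using assms by (intro index_bound) auto
  have "comm_mat m n *\<^sub>v w = vectorize (transpose_mat (unvectorize m n w))"
    using comm_mat_vectorize[of "unvectorize m n w" m n] assms by (simp add: vectorize_unvectorize)
  also have "\<dots> $ (a * n + k) = w $ (k * m + a)"
    using assms b by (auto simp: vectorize_def unvectorize_def)
  finally show ?thesis .
qed

lemma kron_mat_one_carrier: "M \<in> carrier_mat N N \<Longrightarrow> kron_mat (1\<^sub>m n) M \<in> carrier_mat (n * N) (n * N)"
  by (simp add: kron_mat_def)

text \<open>The matrix \<open>1 \<otimes> M\<close> is block diagonal: it applies \<open>M\<close> to each block of length \<open>N\<close> separately.\<close>

lemma index_kron_one_mult:
  assumes M: "M \<in> carrier_mat N N" and w: "w \<in> carrier_vec (n * N)" and "b < n" "k < N"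
  shows "(kron_mat (1\<^sub>m n) M *\<^sub>v w) $ (b * N + k) = (M *\<^sub>v vec N (\<lambda>l. w $ (b * N + l))) $ k"
proof -
  have bk: "b * N + k < n * N" using index_bound[of k N b n] assms by (simp add: mult.commute)
  have "(kron_mat (1\<^sub>m n) M *\<^sub>v w) $ (b * N + k) =
      (\<Sum>j<n * N. kron_mat (1\<^sub>m n) M $$ (b * N + k, j) * w $ j)"
    using M w bk by (auto simp: scalar_prod_def atLeast0LessThan kron_mat_def)
  also have "\<dots> = (\<Sum>c<n. \<Sum>j = c * N..<c * N + N. kron_mat (1\<^sub>m n) M $$ (b * N + k, j) * w $ j)"
    by (rule sum.nat_group[symmetric])
  also have "\<dots> = (\<Sum>c<n. if c = b then (\<Sum>l<N. M $$ (k, l) * w $ (b * N + l)) else 0)"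
  proof (rule sum.cong[OF refl])
    fix c assume "c \<in> {..<n}"
    have "(\<Sum>j = c * N..<c * N + N. kron_mat (1\<^sub>m n) M $$ (b * N + k, j) * w $ j) =
        (\<Sum>l<N. kron_mat (1\<^sub>m n) M $$ (b * N + k, c * N + l) * w $ (c * N + l))"
      using sum.shift_bounds_nat_ivl[of "\<lambda>j. kron_mat (1\<^sub>m n) M $$ (b * N + k, j) * w $ j" 0 "c * N" N]
      by (simp add: add.commute atLeast0LessThan)
    also have "\<dots> = (\<Sum>l<N. of_bool (c = b) * (M $$ (k, l) * w $ (b * N + l)))"
    proof (rule sum.cong[OF refl])
      fix l assume "l \<in> {..<N}"
      then have "c * N + l < n * N" using index_bound[of l N c n] \<open>c \<in> {..<n}\<close> by (simp add: mult.commute)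
      then show "kron_mat (1\<^sub>m n) M $$ (b * N + k, c * N + l) * w $ (c * N + l) =
          of_bool (c = b) * (M $$ (k, l) * w $ (b * N + l))"
        using M bk assms(3,4) \<open>l \<in> {..<N}\<close> \<open>c \<in> {..<n}\<close> by (simp add: kron_mat_def)
    qed
    finally show "(\<Sum>j = c * N..<c * N + N. kron_mat (1\<^sub>m n) M $$ (b * N + k, j) * w $ j) =
        (if c = b then (\<Sum>l<N. M $$ (k, l) * w $ (b * N + l)) else 0)"
      by simp
  qed
  also have "\<dots> = (M *\<^sub>v vec N (\<lambda>l. w $ (b * N + l))) $ k"
    using assms by (auto simp: scalar_prod_def atLeast0LessThan)
  finally show ?thesis .
qed

lemma symmetrizer_carrier: "symmetrizer n r \<in> carrier_mat (n ^ r) (n ^ r)"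
  and symmetrizer_kron_list:
    "length vs = r \<Longrightarrow> set vs \<subseteq> carrier_vec n \<Longrightarrow>
      fact r \<cdot>\<^sub>v (symmetrizer n r *\<^sub>v kron_list vs) =
      finsum_vec TYPE(real) (n ^ r) (\<lambda>\<sigma>. kron_list (permute_list \<sigma> vs)) {\<sigma>. \<sigma> permutes {..<r}}"
  using theI'[OF symmetrizer_ex1[of n r], folded symmetrizer_def] by auto

text \<open>The defining property of the symmetrizer, applied to Kronecker products of unit vectors, yields its
  columns, since these products are the unit vectors of the big space.\<close>

lemma symmetrizer_entry:
  assumes k: "k < n ^ r" and l: "l < n ^ r"
  shows "fact r * symmetrizer n r $$ (k, l) =
    (\<Sum>\<sigma> | \<sigma> permutes {..<r}. of_bool (permute_list \<sigma> (multi_index n r l) = multi_index n r k))"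
proof -
  let ?P = "{\<sigma>. \<sigma> permutes {..<r}}"
  let ?vs = "map (unit_vec n) (multi_index n r l) :: real vec list"
  have vs: "length ?vs = r" "set ?vs \<subseteq> carrier_vec n" by auto
  have perm: "kron_list (permute_list \<sigma> ?vs) = unit_vec (n ^ r) (position n (permute_list \<sigma> (multi_index n r l)))"
    (is "_ = unit_vec _ (position n ?is)") and lt: "position n (permute_list \<sigma> (multi_index n r l)) < n ^ r"
    and mi: "multi_index n r (position n (permute_list \<sigma> (multi_index n r l))) = permute_list \<sigma> (multi_index n r l)"
    if \<sigma>: "\<sigma> permutes {..<r}" for \<sigma>
  proof -
    have s: "set ?is \<subseteq> {..<n}" "length ?is = r" using \<sigma> set_multi_index[OF l] by auto
    show lt: "position n ?is < n ^ r" using position_less[OF s(1)] s by simp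
    show mi: "multi_index n r (position n ?is) = ?is" using multi_index_position[OF s(1)] s by simp
    have "permute_list \<sigma> ?vs = map (unit_vec n) ?is" using \<sigma> by (simp add: permute_list_map)
    also have "\<dots> = map (unit_vec n) (multi_index n r (position n ?is))" by (simp add: mi)
    finally show "kron_list (permute_list \<sigma> ?vs) = unit_vec (n ^ r) (position n ?is)"
      by (simp add: kron_list_unit_vecs[OF lt])
  qed
  have "fact r * symmetrizer n r $$ (k, l) = (fact r \<cdot>\<^sub>v (symmetrizer n r *\<^sub>v unit_vec (n ^ r) l)) $ k"
    using symmetrizer_carrier[of n r] k l by (simp add: mult_unit_vec[OF symmetrizer_carrier])
  also have "\<dots> = finsum_vec TYPE(real) (n ^ r) (\<lambda>\<sigma>. kron_list (permute_list \<sigma> ?vs)) ?P $ k"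
    using arg_cong[OF symmetrizer_kron_list[of ?vs r n], of "\<lambda>v. v $ k"] vs
    by (simp only: kron_list_unit_vecs[OF l])
  also have "\<dots> = (\<Sum>\<sigma>\<in>?P. kron_list (permute_list \<sigma> ?vs) $ k)"
    using k by (intro index_finsum_vec) (auto simp: finite_permutations perm)
  also have "\<dots> = (\<Sum>\<sigma>\<in>?P. of_bool (permute_list \<sigma> (multi_index n r l) = multi_index n r k))"
  proof (rule sum.cong[OF refl])
    fix \<sigma> assume "\<sigma> \<in> ?P"
    then have \<sigma>: "\<sigma> permutes {..<r}" by simp
    have "k = position n (permute_list \<sigma> (multi_index n r l)) \<longleftrightarrow>
        permute_list \<sigma> (multi_index n r l) = multi_index n r k"
      using mi[OF \<sigma>] position_multi_index[OF k] by metis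
    then show "kron_list (permute_list \<sigma> ?vs) $ k = of_bool (permute_list \<sigma> (multi_index n r l) = multi_index n r k)"
      using k lt[OF \<sigma>] by (auto simp: perm[OF \<sigma>])
  qed
  finally show ?thesis .
qed

lemma permute_list_eq_iff:
  assumes \<sigma>: "\<sigma> permutes {..<length xs}" and len: "length ys = length xs"
  shows "permute_list \<sigma> xs = ys \<longleftrightarrow> xs = permute_list (Hilbert_Choice.inv \<sigma>) ys"
proof -
  have inv: "Hilbert_Choice.inv \<sigma> permutes {..<length xs}" using permutes_inv[OF \<sigma>] .
  have "permute_list (Hilbert_Choice.inv \<sigma>) (permute_list \<sigma> xs) = xs"
    using permute_list_compose[OF inv, of \<sigma>] permutes_inv_o(1)[OF \<sigma>] by simp
  moreover have "permute_list \<sigma> (permute_list (Hilbert_Choice.inv \<sigma>) ys) = ys"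
    using permute_list_compose[of \<sigma> ys "Hilbert_Choice.inv \<sigma>"] permutes_inv_o(2)[OF \<sigma>] \<sigma> len by simp
  ultimately show ?thesis by metis
qed

text \<open>The defining property speaks of Kronecker products only, but the vector to be symmetrized here is
  not one. By linearity, the symmetrizer averages the entries of any vector over all
  reorderings of the multi-index.\<close>

lemma index_symmetrizer_mult:
  assumes w: "w \<in> carrier_vec (n ^ r)" and k: "k < n ^ r"
  shows "fact r * (symmetrizer n r *\<^sub>v w) $ k =
    (\<Sum>zs\<in>permutations_of_set {..<r}. w $ position n (map ((!) (multi_index n r k)) zs))"
proof -
  let ?P = "{\<sigma>. \<sigma> permutes {..<r}}"
  let ?mi = "multi_index n r"
  have "fact r * (symmetrizer n r *\<^sub>v w) $ k = (\<Sum>l<n ^ r. fact r * symmetrizer n r $$ (k, l) * w $ l)"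
    using symmetrizer_carrier[of n r] w k
    by (auto simp: scalar_prod_def atLeast0LessThan sum_distrib_left mult.assoc)
  also have "\<dots> = (\<Sum>l<n ^ r. \<Sum>\<sigma>\<in>?P. of_bool (permute_list \<sigma> (?mi l) = ?mi k) * w $ l)"
    by (intro sum.cong) (auto simp: symmetrizer_entry[OF k] sum_distrib_right)
  also have "\<dots> = (\<Sum>\<sigma>\<in>?P. \<Sum>l<n ^ r. of_bool (permute_list \<sigma> (?mi l) = ?mi k) * w $ l)"
    by (rule sum.swap)
  also have "\<dots> = (\<Sum>\<sigma>\<in>?P. w $ position n (permute_list (Hilbert_Choice.inv \<sigma>) (?mi k)))"
  proof (rule sum.cong[OF refl])
    fix \<sigma> assume "\<sigma> \<in> ?P"
    then have \<sigma>: "\<sigma> permutes {..<r}" by simp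
    define js where "js = permute_list (Hilbert_Choice.inv \<sigma>) (?mi k)"
    have js: "set js \<subseteq> {..<n}" "length js = r"
      using permutes_inv[OF \<sigma>] set_multi_index[OF k] by (auto simp: js_def)
    have lt: "position n js < n ^ r" using position_less[OF js(1)] js by simp
    have "permute_list \<sigma> (?mi l) = ?mi k \<longleftrightarrow> l = position n js" if "l < n ^ r" for l
      using permute_list_eq_iff[of \<sigma> "?mi l" "?mi k"] \<sigma> position_multi_index[OF that]
        multi_index_position[OF js(1)] js(2) by (auto simp: js_def[symmetric])
    then have "(\<Sum>l<n ^ r. of_bool (permute_list \<sigma> (?mi l) = ?mi k) * w $ l) =
        (\<Sum>l<n ^ r. if l = position n js then w $ l else 0)"
      by (intro sum.cong) auto
    then show "(\<Sum>l<n ^ r. of_bool (permute_list \<sigma> (?mi l) = ?mi k) * w $ l) =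
        w $ position n (permute_list (Hilbert_Choice.inv \<sigma>) (?mi k))"
      using lt by (simp add: js_def)
  qed
  also have "\<dots> = (\<Sum>\<sigma>\<in>?P. w $ position n (permute_list \<sigma> (?mi k)))"
    by (rule sum_permutations_inverse[symmetric])
  also have "\<dots> = (\<Sum>\<sigma>\<in>?P. w $ position n (map ((!) (?mi k)) (map \<sigma> [0..<r])))"
    by (simp add: permute_list_def comp_def)
  also have "\<dots> = (\<Sum>zs\<in>permutations_of_set {..<r}. w $ position n (map ((!) (?mi k)) zs))"
    by (rule sum_permutes_eq_sum_permutations_of_set)
  finally show ?thesis .
qed

lemma dim_kron_pow: "dim_vec (kron_pow v r) = dim_vec v ^ r"
  by (induction r) (auto simp: kron_pow_def kron_vec_def)

lemma index_kron_pow_Suc: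
  assumes "c < dim_vec v" "k < dim_vec v ^ r"
  shows "kron_pow v (Suc r) $ (c * dim_vec v ^ r + k) = v $ c * kron_pow v r $ k"
proof -
  define N where "N = dim_vec v ^ r"
  have "c * N + k < N * dim_vec v" "k < N"
    using assms by (auto simp: N_def intro!: index_bound)
  then show ?thesis
    using dim_kron_pow[of v r]
    by (simp add: kron_pow_def kron_vec_def N_def[symmetric] mult.commute[of "dim_vec v"])
qed

lemma index_vectorize:
  assumes "Y \<in> carrier_mat m n" "a < m" "b < n"
  shows "vectorize Y $ (b * m + a) = Y $$ (a, b)"
  using assms index_bound[of a m b n] by (simp add: vectorize_def)

text \<open>Reading the multi-index of the Kronecker power in base \<open>d\<close> as \<open>(b, q\<^sub>1, p\<^sub>1, \<dots>, q\<^sub>r, p\<^sub>r, a)\<close> and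
  cutting it into pairs from the left gives \<open>(b, q\<^sub>1), (p\<^sub>1, q\<^sub>2), \<dots>, (p\<^sub>r, a)\<close>: the factors of a
  chain product, each with the column before the row.\<close>

lemma kron_pow_vectorize_eq_chain_product:
  assumes Y: "Y \<in> carrier_mat d d" and "set js \<subseteq> {..<d * d}" "a < d" "b < d"
  shows "kron_pow (vectorize Y) (Suc (length js))
      $ (b * (d * (d * d) ^ length js) + position (d * d) js * d + a) = chain_product d Y js b a"
  using assms(2-)
proof (induction js arbitrary: b)
  case Nil
  have "b * d + a < d * d" using index_bound Nil by blast
  then show ?case
    using index_kron_pow_Suc[of "b * d + a" "vectorize Y" 0 0] Y Nil
    by (simp add: kron_pow_def) (simp add: vectorize_def)
next
  case (Cons j js)
  let ?M = "(d * d) ^ length js"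
  have j: "j mod d < d" "j div d < d"
    using Cons.prems div_bound[of j d d] mod_bound[of j d d] by auto
  have dim: "dim_vec (vectorize Y) = d * d" using Y by simp
  have c: "b * d + j div d < d * d" using index_bound j(2) Cons.prems(3) by blast
  have "position (d * d) js * d + a < d * ?M"
    using position_less[of js "d * d"] Cons.prems by (intro index_bound) auto
  from index_bound[OF this j(1)]
  have k: "j mod d * (d * ?M) + (position (d * d) js * d + a) < (d * d) ^ Suc (length js)"
    by (simp add: mult_ac)
  have "b * (d * (d * d) ^ length (j # js)) + position (d * d) (j # js) * d + a =
      b * d * (d * d * ?M) + j * (d * ?M) + (position (d * d) js * d + a)"
    by (simp add: position_Cons distrib_left mult_ac add_ac)
  also have "j * (d * ?M) = (j div d * d + j mod d) * (d * ?M)" by simp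
  also have "b * d * (d * d * ?M) + \<dots> + (position (d * d) js * d + a) =
      (b * d + j div d) * (d * d) ^ Suc (length js) +
      (j mod d * (d * ?M) + (position (d * d) js * d + a))"
    by (simp only: power_Suc distrib_left distrib_right mult_ac add_ac)
  finally have e: "b * (d * (d * d) ^ length (j # js)) + position (d * d) (j # js) * d + a = \<dots>" .
  have "kron_pow (vectorize Y) (Suc (length (j # js)))
      $ (b * (d * (d * d) ^ length (j # js)) + position (d * d) (j # js) * d + a) =
      vectorize Y $ (b * d + j div d) *
      kron_pow (vectorize Y) (Suc (length js)) $ (j mod d * (d * ?M) + (position (d * d) js * d + a))"
    unfolding e unfolding length_Cons by (rule index_kron_pow_Suc[where v = "vectorize Y", unfolded dim, OF c k])
  also have "vectorize Y $ (b * d + j div d) = Y $$ (j div d, b)"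
    by (rule index_vectorize[OF Y j(2) Cons.prems(3)])
  also have "kron_pow (vectorize Y) (Suc (length js)) $ (j mod d * (d * ?M) + (position (d * d) js * d + a)) =
      chain_product d Y js (j mod d) a"
    unfolding add.assoc[symmetric] using Cons.prems j(1) by (intro Cons.IH) auto
  also have "Y $$ (j div d, b) * chain_product d Y js (j mod d) a = chain_product d Y (j # js) b a" by simp
  finally show ?case .
qed

text \<open>The factor \<open>1 \<otimes> K\<close> acts behind the leading digit \<open>b = l div d\<close> and brings the last digit of the
  multi-index to the front, so the entry at \<open>l\<close> followed by the directions \<open>js\<close> becomes the chain
  product from \<open>b\<close> to \<open>l mod d\<close> along \<open>js\<close>; the symmetrizer then acts on \<open>js\<close>.\<close>

lemma symmetrized_commuted_kron_pow:
  assumes Y: "Y \<in> carrier_mat d d" and l: "l < d * d" and k: "k < (d * d) ^ r"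
  shows "fact r * ((kron_mat (1\<^sub>m (d * d)) (symmetrizer (d * d) r) *
      kron_mat (1\<^sub>m d) (comm_mat d ((d * d) ^ r))) *\<^sub>v kron_pow (vectorize Y) (r + 1)) $ (l * (d * d) ^ r + k) =
    (\<Sum>zs\<in>permutations_of_set {..<r}.
       chain_product d Y (map ((!) (multi_index (d * d) r k)) zs) (l div d) (l mod d))"
proof -
  let ?N = "(d * d) ^ r" and ?z = "kron_pow (vectorize Y) (r + 1)"
  let ?K = "kron_mat (1\<^sub>m d) (comm_mat d ?N)" and ?S = "kron_mat (1\<^sub>m (d * d)) (symmetrizer (d * d) r)"
  have dN: "d * (d * ?N) = d * d * ?N" by simp
  have ab: "l mod d < d" "l div d < d" using l div_bound mod_bound by auto
  have K: "?K \<in> carrier_mat (d * d * ?N) (d * d * ?N)"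
    using kron_mat_one_carrier[OF comm_mat_carrier[of d ?N], of d] unfolding dN .
  have S: "?S \<in> carrier_mat (d * d * ?N) (d * d * ?N)"
    by (rule kron_mat_one_carrier[OF symmetrizer_carrier])
  have z: "?z \<in> carrier_vec (d * d * ?N)"
    using Y dim_kron_pow[of "vectorize Y" "r + 1"] by (intro carrier_vecI) simp
  have Kz: "?K *\<^sub>v ?z \<in> carrier_vec (d * d * ?N)" using K z by (rule mult_mat_vec_carrier)
  have entry: "(?K *\<^sub>v ?z) $ (l * ?N + position (d * d) js) = chain_product d Y js (l div d) (l mod d)"
    if js: "set js \<subseteq> {..<d * d}" "length js = r" for js
  proof -
    have m: "position (d * d) js < ?N" using position_less[OF js(1)] js(2) by simp
    have i: "l mod d * ?N + position (d * d) js < d * ?N"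
      using index_bound[OF m ab(1)] by (simp add: mult.commute)
    have "l * ?N = (l div d * d + l mod d) * ?N" by simp
    also have "\<dots> = l div d * (d * ?N) + l mod d * ?N"
      by (simp only: distrib_right mult.assoc)
    finally have pos: "l * ?N + position (d * d) js = l div d * (d * ?N) + (l mod d * ?N + position (d * d) js)"
      by simp
    have "(?K *\<^sub>v ?z) $ (l * ?N + position (d * d) js) =
        (comm_mat d ?N *\<^sub>v vec (d * ?N) (\<lambda>i. ?z $ (l div d * (d * ?N) + i)))
          $ (l mod d * ?N + position (d * d) js)"
      unfolding pos using z ab(2) i by (intro index_kron_one_mult[OF comm_mat_carrier]) (simp_all only: dN)
    also have "\<dots> = vec (d * ?N) (\<lambda>i. ?z $ (l div d * (d * ?N) + i)) $ (position (d * d) js * d + l mod d)"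
      using ab(1) m by (intro index_comm_mat_mult) auto
    also have "\<dots> = ?z $ (l div d * (d * ?N) + (position (d * d) js * d + l mod d))"
      using index_bound[OF ab(1) m] by simp
    also have "\<dots> = chain_product d Y js (l div d) (l mod d)"
      using kron_pow_vectorize_eq_chain_product[OF Y js(1) ab] js(2) by (simp add: add.assoc)
    finally show ?thesis .
  qed
  have "((?S * ?K) *\<^sub>v ?z) $ (l * ?N + k) = (?S *\<^sub>v (?K *\<^sub>v ?z)) $ (l * ?N + k)"
    using S K z by (simp add: assoc_mult_mat_vec)
  also have "\<dots> = (symmetrizer (d * d) r *\<^sub>v vec ?N (\<lambda>i. (?K *\<^sub>v ?z) $ (l * ?N + i))) $ k"
    by (rule index_kron_one_mult[OF symmetrizer_carrier Kz l k])
  finally have "fact r * ((?S * ?K) *\<^sub>v ?z) $ (l * ?N + k) =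
      fact r * (symmetrizer (d * d) r *\<^sub>v vec ?N (\<lambda>i. (?K *\<^sub>v ?z) $ (l * ?N + i))) $ k"
    by (rule arg_cong)
  also have "\<dots> = (\<Sum>zs\<in>permutations_of_set {..<r}.
      vec ?N (\<lambda>i. (?K *\<^sub>v ?z) $ (l * ?N + i)) $ position (d * d) (map ((!) (multi_index (d * d) r k)) zs))"
    by (rule index_symmetrizer_mult[OF _ k]) simp
  also have "\<dots> = (\<Sum>zs\<in>permutations_of_set {..<r}.
       chain_product d Y (map ((!) (multi_index (d * d) r k)) zs) (l div d) (l mod d))"
  proof (rule sum.cong[OF refl])
    fix zs assume zs: "zs \<in> permutations_of_set {..<r}"
    let ?js = "map ((!) (multi_index (d * d) r k)) zs"
    have "multi_index (d * d) r k ! i < d * d" if "i < r" for i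
      using set_multi_index[OF k] that nth_mem by (metis length_multi_index lessThan_iff subsetD)
    then have js: "set ?js \<subseteq> {..<d * d}" "length ?js = r"
      using permutations_of_setD(1)[OF zs] length_finite_permutations_of_set[OF zs] by auto
    then have "position (d * d) ?js < ?N" using position_less[OF js(1)] by simp
    then show "vec ?N (\<lambda>i. (?K *\<^sub>v ?z) $ (l * ?N + i)) $ position (d * d) ?js =
        chain_product d Y ?js (l div d) (l mod d)"
      using entry[OF js] by simp
  qed
  finally show ?thesis .
qed

section \<open>Partial derivatives of the entries of the inverse\<close>

text \<open>If \<open>Z\<close> varies like the inverse of a matrix moving in the direction \<open>i\<close>, then differentiating a
  factor splits it into two with \<open>i\<close> in between. The product has one factor more than \<open>js\<close> has
  elements, and so as many factors as there are places to insert \<open>i\<close>.\<close>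

lemma DERIV_chain_product:
  assumes "\<And>a b. a < d \<Longrightarrow> b < d \<Longrightarrow>
      ((\<lambda>t. Z t $$ (a, b)) has_field_derivative - (Z 0 $$ (a, i mod d) * Z 0 $$ (i div d, b))) (at 0)"
    and "set js \<subseteq> {..<d * d}" "a < d" "b < d"
  shows "((\<lambda>t. chain_product d (Z t) js b a) has_field_derivative
      - (\<Sum>m\<le>length js. chain_product d (Z 0) (take m js @ i # drop m js) b a)) (at 0)"
  using assms(2-)
proof (induction js arbitrary: b)
  case Nil
  then show ?case using assms(1)[of a b] by (simp add: mult.commute)
next
  case (Cons j js)
  have j: "j mod d < d" "j div d < d"
    using Cons.prems div_bound[of j d d] mod_bound[of j d d] by auto
  have "((\<lambda>t. chain_product d (Z t) js (j mod d) a) has_field_derivative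
      - (\<Sum>m\<le>length js. chain_product d (Z 0) (take m js @ i # drop m js) (j mod d) a)) (at 0)"
    using Cons j by simp
  from DERIV_mult[OF assms(1)[OF j(2) Cons.prems(3)] this]
  show ?case
    by (simp add: sum.atMost_Suc_shift sum_distrib_left algebra_simps del: sum.atMost_Suc)
qed

text \<open>The Sherman-Morrison identity for a multiple of a matrix unit. With the coefficient
  \<open>c = t / (1 + t * Y\<^sub>q\<^sub>p)\<close> the three contributions proportional to \<open>Y\<^sub>q\<^sub>b\<close> in row \<open>p\<close> cancel.\<close>

lemma rank_one_update_inverse:
  fixes X Y :: "real mat"
  assumes X: "X \<in> carrier_mat d d" and Y: "Y \<in> carrier_mat d d" and XY: "X * Y = 1\<^sub>m d"
    and pq: "p < d" "q < d" and nz: "1 + t * Y $$ (q, p) \<noteq> 0"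
  defines "Z \<equiv> mat d d (\<lambda>(a, b). Y $$ (a, b) - t * Y $$ (a, p) * Y $$ (q, b) / (1 + t * Y $$ (q, p)))"
  shows "(X + mat d d (\<lambda>(a, b). if a = p \<and> b = q then t else 0)) * Z = 1\<^sub>m d"
proof (rule eq_matI)
  fix a b assume "a < dim_row (1\<^sub>m d)" "b < dim_col (1\<^sub>m d)"
  then have ab: "a < d" "b < d" by auto
  define c where "c = t / (1 + t * Y $$ (q, p))"
  have XYe: "(\<Sum>k<d. X $$ (a, k) * Y $$ (k, e)) = of_bool (a = e)" if "e < d" for e
  proof -
    have "(X * Y) $$ (a, e) = (\<Sum>k<d. X $$ (a, k) * Y $$ (k, e))"
      using X Y ab that by (auto simp: scalar_prod_def atLeast0LessThan)
    moreover have "(X * Y) $$ (a, e) = of_bool (a = e)" using ab that by (simp add: XY)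
    ultimately show ?thesis by simp
  qed
  have "((X + mat d d (\<lambda>(a, b). if a = p \<and> b = q then t else 0)) * Z) $$ (a, b) =
      (\<Sum>k<d. (X $$ (a, k) + (if a = p \<and> k = q then t else 0)) *
              (Y $$ (k, b) - c * Y $$ (k, p) * Y $$ (q, b)))"
    using X Y ab by (auto simp: scalar_prod_def atLeast0LessThan Z_def c_def intro!: sum.cong)
  also have "\<dots> = (\<Sum>k<d. X $$ (a, k) * Y $$ (k, b)) -
      c * Y $$ (q, b) * (\<Sum>k<d. X $$ (a, k) * Y $$ (k, p)) +
      (\<Sum>k<d. if k = q then of_bool (a = p) * t * (Y $$ (k, b) - c * Y $$ (k, p) * Y $$ (q, b)) else 0)"
    unfolding sum_distrib_left sum_subtractf[symmetric] sum.distrib[symmetric]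
    by (intro sum.cong) (auto simp: algebra_simps)
  also have "\<dots> = of_bool (a = b) + of_bool (a = p) * Y $$ (q, b) * (t - c * (1 + t * Y $$ (q, p)))"
    using pq ab by (simp add: XYe algebra_simps)
  also have "t - c * (1 + t * Y $$ (q, p)) = 0"
    using nz by (simp add: c_def)
  finally show "((X + mat d d (\<lambda>(a, b). if a = p \<and> b = q then t else 0)) * Z) $$ (a, b) = 1\<^sub>m d $$ (a, b)"
    using ab by simp
qed (use X in \<open>auto simp: Z_def\<close>)

locale matrix_inverse =
  fixes d :: nat and F :: "real mat \<Rightarrow> real mat"
  assumes F: "\<And>X. X \<in> carrier_mat d d \<Longrightarrow> invertible_mat X \<Longrightarrow>
    F X \<in> carrier_mat d d \<and> inverts_mat X (F X) \<and> inverts_mat (F X) X"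
begin

abbreviation entry :: "nat \<Rightarrow> real vec \<Rightarrow> real" where
  "entry l x \<equiv> vectorize (F (unvectorize d d x)) $ l"

lemma F_carrier: "X \<in> carrier_mat d d \<Longrightarrow> invertible_mat X \<Longrightarrow> F X \<in> carrier_mat d d"
  using F by blast

lemma invertible_and_F_eqI:
  assumes X: "X \<in> carrier_mat d d" and Y: "Y \<in> carrier_mat d d" and XY: "X * Y = 1\<^sub>m d"
  shows "invertible_mat X" "F X = Y"
proof -
  have YX: "Y * X = 1\<^sub>m d" by (rule mat_mult_left_right_inverse[OF X Y XY])
  show inv: "invertible_mat X"
    using X Y XY YX by (auto simp: invertible_mat_def inverts_mat_def)
  have "F X = Y * X * F X" using F_carrier[OF X inv] by (simp add: YX)
  also have "\<dots> = Y * (X * F X)" using F_carrier[OF X inv] X Y by (simp add: assoc_mult_mat)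
  also have "X * F X = 1\<^sub>m d" using F[OF X inv] X by (simp add: inverts_mat_def)
  finally show "F X = Y" using Y by simp
qed

text \<open>The induction step for partial derivatives of every order. The function \<open>g\<close> is known at invertible
  matrices only; this suffices for its derivative because the line stays invertible near \<open>0\<close>. The sum
  over an arbitrary family of chain products is what iterated derivatives look like, up to the
  factor \<open>c\<close>.\<close>

lemma DERIV_along_unit_vec:
  assumes X: "X \<in> carrier_mat d d" "invertible_mat X" and i: "i < d * d" and ab: "a < d" "b < d"
    and W: "\<And>z. z \<in> W \<Longrightarrow> set (js z) \<subseteq> {..<d * d}"
    and g: "\<And>X'. X' \<in> carrier_mat d d \<Longrightarrow> invertible_mat X' \<Longrightarrow>
      g (vectorize X') = c * (\<Sum>z\<in>W. chain_product d (F X') (js z) b a)"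
  shows "((\<lambda>t. g (vectorize X + t \<cdot>\<^sub>v unit_vec (d * d) i)) has_field_derivative
    - c * (\<Sum>z\<in>W. \<Sum>m\<le>length (js z). chain_product d (F X) (take m (js z) @ i # drop m (js z)) b a)) (at 0)"
proof -
  let ?p = "i mod d" and ?q = "i div d"
  have pq: "?p < d" "?q < d" using i div_bound mod_bound by auto
  define Y where "Y = F X"
  have Y: "Y \<in> carrier_mat d d" using F_carrier X by (simp add: Y_def)
  have XY: "X * Y = 1\<^sub>m d" using F[OF X] X by (simp add: inverts_mat_def Y_def)
  define Z where "Z t = mat d d (\<lambda>(a, b).
    Y $$ (a, b) - t * Y $$ (a, ?p) * Y $$ (?q, b) / (1 + t * Y $$ (?q, ?p)))" for t
  have Z0: "Z 0 = Y" using Y by (intro eq_matI) (auto simp: Z_def)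
  have dZ: "((\<lambda>t. Z t $$ (a, b)) has_field_derivative - (Z 0 $$ (a, ?p) * Z 0 $$ (?q, b))) (at 0)"
    if "a < d" "b < d" for a b
    using that pq Y unfolding Z0 by (auto simp: Z_def intro!: derivative_eq_intros)
  have "((\<lambda>t. c * (\<Sum>z\<in>W. chain_product d (Z t) (js z) b a)) has_field_derivative
      c * (\<Sum>z\<in>W. - (\<Sum>m\<le>length (js z). chain_product d (Z 0) (take m (js z) @ i # drop m (js z)) b a))) (at 0)"
    by (intro DERIV_cmult DERIV_sum DERIV_chain_product W dZ ab)
  also have "c * (\<Sum>z\<in>W. - (\<Sum>m\<le>length (js z). chain_product d (Z 0) (take m (js z) @ i # drop m (js z)) b a)) =
      - c * (\<Sum>z\<in>W. \<Sum>m\<le>length (js z). chain_product d (F X) (take m (js z) @ i # drop m (js z)) b a)"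
    by (simp add: sum_negf Z0 Y_def)
  finally have D: "((\<lambda>t. c * (\<Sum>z\<in>W. chain_product d (Z t) (js z) b a)) has_field_derivative \<dots>) (at 0)" .
  \<comment> \<open>The denominator does not vanish near \<open>0\<close>, so there the line runs through invertible matrices.\<close>
  have "((\<lambda>t. 1 + t * Y $$ (?q, ?p)) \<longlongrightarrow> 1 + 0 * Y $$ (?q, ?p)) (nhds 0)"
    by (intro tendsto_intros filterlim_ident)
  then have "\<forall>\<^sub>F t in nhds 0. 1 + t * Y $$ (?q, ?p) \<noteq> 0"
    by (rule tendsto_imp_eventually_ne) simp
  then have "\<forall>\<^sub>F t in nhds 0. g (vectorize X + t \<cdot>\<^sub>v unit_vec (d * d) i) =
      c * (\<Sum>z\<in>W. chain_product d (Z t) (js z) b a)"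
  proof eventually_elim
    case (elim t)
    define E where "E = mat d d (\<lambda>(a, b). if a = ?p \<and> b = ?q then t else 0)"
    have "(X + E) * Z t = 1\<^sub>m d"
      unfolding E_def Z_def by (rule rank_one_update_inverse[OF X(1) Y XY pq elim])
    then have inv: "invertible_mat (X + E)" "F (X + E) = Z t"
      using invertible_and_F_eqI[of "X + E" "Z t"] X(1) by (auto simp: E_def Z_def)
    have unit: "k mod d = ?p \<and> k div d = ?q \<longleftrightarrow> k = i" for k
      by (metis div_mult_mod_eq)
    have "vectorize X + t \<cdot>\<^sub>v unit_vec (d * d) i = vectorize (X + E)"
    proof (rule eq_vecI)
      fix k assume "k < dim_vec (vectorize (X + E))"
      then have k: "k < d * d" using X(1) by (simp add: E_def)
      have "vectorize (X + E) $ k = X $$ (k mod d, k div d) + (if k = i then t else 0)"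
        using X(1) k div_bound[OF k] mod_bound[OF k] by (simp add: vectorize_def E_def unit)
      then show "(vectorize X + t \<cdot>\<^sub>v unit_vec (d * d) i) $ k = vectorize (X + E) $ k"
        using X(1) k i by (simp add: vectorize_def)
    qed (use X(1) in \<open>simp add: E_def\<close>)
    moreover have "X + E \<in> carrier_mat d d" using X(1) by (simp add: E_def)
    ultimately show ?case using g inv by simp
  qed
  with D show ?thesis by (subst DERIV_cong_ev) auto
qed

text \<open>The directions may repeat, so they are given as the values of \<open>e\<close> on a list of distinct names: then
  orderings of the names form a set, without multiplicities, and the induction on the list stays
  within the same form.\<close>

lemma iter_partial_entry:
  assumes "distinct ks" "e ` set ks \<subseteq> {..<d * d}" and l: "l < d * d"
    and X: "X \<in> carrier_mat d d" "invertible_mat X"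
  shows "iter_partial (map e ks) (entry l) (vectorize X) =
    (- 1) ^ length ks * (\<Sum>zs\<in>permutations_of_set (set ks). chain_product d (F X) (map e zs) (l div d) (l mod d))"
  using assms(1,2) X
proof (induction ks arbitrary: X)
  case Nil
  have "unvectorize d d (vectorize X) = X" using Nil by (intro unvectorize_vectorize)
  then show ?case using F_carrier[of X] Nil l by (simp add: vectorize_def)
next
  case (Cons k ks)
  have ab: "l mod d < d" "l div d < d" using l div_bound mod_bound by auto
  let ?c = "(- 1) ^ length ks :: real" and ?P = "permutations_of_set (set ks)"
  have k: "k \<notin> set ks" "e k < d * d" using Cons.prems by auto
  have len: "length zs = card (set ks)" if "zs \<in> ?P" for zs
    using that by (rule length_finite_permutations_of_set)
  have "((\<lambda>t. iter_partial (map e ks) (entry l) (vectorize X + t \<cdot>\<^sub>v unit_vec (d * d) (e k)))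
      has_field_derivative - ?c * (\<Sum>zs\<in>?P. \<Sum>m\<le>length (map e zs).
        chain_product d (F X) (take m (map e zs) @ e k # drop m (map e zs)) (l div d) (l mod d))) (at 0)"
  proof (rule DERIV_along_unit_vec)
    fix zs assume "zs \<in> ?P"
    then have "set zs = set ks" by (rule permutations_of_setD)
    then show "set (map e zs) \<subseteq> {..<d * d}" using Cons.prems(2) by auto
  qed (use Cons k ab in auto)
  then have "iter_partial (map e (k # ks)) (entry l) (vectorize X) =
      - ?c * (\<Sum>zs\<in>?P. \<Sum>m\<le>length (map e zs).
        chain_product d (F X) (take m (map e zs) @ e k # drop m (map e zs)) (l div d) (l mod d))"
    using Cons.prems(3) by (simp add: partial_deriv_def DERIV_imp_deriv)
  also have "\<dots> = - ?c * (\<Sum>zs\<in>?P. \<Sum>m\<le>card (set ks).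
        chain_product d (F X) (map e (take m zs @ k # drop m zs)) (l div d) (l mod d))"
    by (simp add: len take_map drop_map cong: sum.cong)
  also have "\<dots> = - ?c * (\<Sum>zs\<in>permutations_of_set (insert k (set ks)).
        chain_product d (F X) (map e zs) (l div d) (l mod d))"
    by (subst sum_permutations_insert) (use k in auto)
  finally show ?case by simp
qed

lemma iter_partial_entry_nth:
  assumes "set is \<subseteq> {..<d * d}" "l < d * d" "X \<in> carrier_mat d d" "invertible_mat X"
  shows "iter_partial is (entry l) (vectorize X) =
    (- 1) ^ length is * (\<Sum>zs\<in>permutations_of_set {..<length is}.
      chain_product d (F X) (map ((!) is) zs) (l div d) (l mod d))"
proof -
  have "(!) is ` set [0..<length is] \<subseteq> {..<d * d}" using assms(1) nth_mem by fastforce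
  from iter_partial_entry[OF _ this assms(2-4)] show ?thesis
    by (simp add: map_nth atLeast0LessThan)
qed

lemma partially_differentiable_on_entry:
  "partially_differentiable_on r (\<lambda>x. vectorize (F (unvectorize d d x)))
     {vectorize X | X. X \<in> carrier_mat d d \<and> invertible_mat X}"
  unfolding partially_differentiable_on_def
proof (intro ballI allI impI)
  fix x l "is" i
  assume "x \<in> {vectorize X | X. X \<in> carrier_mat d d \<and> invertible_mat X}"
    and l: "l < dim_vec (vectorize (F (unvectorize d d x)))"
    and i: "length is < r \<and> set (i # is) \<subseteq> {..<dim_vec x}"
  then obtain X where x: "x = vectorize X" and X: "X \<in> carrier_mat d d" "invertible_mat X" by blast
  have l: "l < d * d"
    using l F_carrier[OF X] X by (simp add: x unvectorize_vectorize)
  then have ab: "l mod d < d" "l div d < d" using div_bound mod_bound by auto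
  have i: "i < d * d" "set is \<subseteq> {..<d * d}" using i X by (auto simp: x)
  have "((\<lambda>t. iter_partial is (entry l) (vectorize X + t \<cdot>\<^sub>v unit_vec (d * d) i)) has_field_derivative
    - ((- 1) ^ length is) * (\<Sum>zs\<in>permutations_of_set {..<length is}. \<Sum>m\<le>length (map ((!) is) zs).
      chain_product d (F X) (take m (map ((!) is) zs) @ i # drop m (map ((!) is) zs)) (l div d) (l mod d))) (at 0)"
  proof (rule DERIV_along_unit_vec[OF X i(1) ab _ iter_partial_entry_nth[OF i(2) l]])
    fix zs assume "zs \<in> permutations_of_set {..<length is}"
    then have "set zs = {..<length is}" by (rule permutations_of_setD)
    then show "set (map ((!) is) zs) \<subseteq> {..<d * d}" using i(2) nth_mem by fastforce
  qed
  then show "(\<lambda>t. iter_partial is (entry l) (x + t \<cdot>\<^sub>v unit_vec (dim_vec x) i)) field_differentiable at 0"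
    using X by (auto simp: x field_differentiable_def)
qed

text \<open>Entry \<open>k\<close> of the derivative belongs to the matrix entry \<open>k div N\<close>, where \<open>N = (d * d) ^ r\<close>,
  and to the directions with multi-index \<open>k mod N\<close>; both sides are the same sum over orderings of these directions.\<close>

lemma mat_vderiv_eq:
  assumes X: "X \<in> carrier_mat d d" "invertible_mat X"
  shows "mat_vderiv r F X = ((- 1) ^ r * fact r) \<cdot>\<^sub>v
    ((kron_mat (1\<^sub>m (d * d)) (symmetrizer (d * d) r) *
      kron_mat (1\<^sub>m d) (comm_mat d ((d * d) ^ r))) *\<^sub>v kron_pow (vectorize (F X)) (r + 1))"
    (is "_ = _ \<cdot>\<^sub>v ?R")
proof (rule eq_vecI)
  let ?N = "(d * d) ^ r"
  note Y = F_carrier[OF X]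
  have D: "mat_vderiv r F X = vec (d * d * ?N) (\<lambda>k. vderiv_scalar r (entry (k div ?N)) (vectorize X) $ (k mod ?N))"
    using X Y by (simp add: mat_vderiv_def vderiv_def Let_def unvectorize_vectorize)
  have "dim_vec ?R = d * d * ?N"
    using symmetrizer_carrier[of "d * d" r] by (simp add: kron_mat_def)
  then show "dim_vec (mat_vderiv r F X) = dim_vec (((- 1) ^ r * fact r) \<cdot>\<^sub>v ?R)"
    by (simp add: D)
  fix k assume "k < dim_vec (((- 1) ^ r * fact r) \<cdot>\<^sub>v ?R)"
  then have k: "k < ?N * (d * d)" using \<open>dim_vec ?R = _\<close> by (simp add: mult.commute)
  let ?l = "k div ?N" and ?m = "k mod ?N"
  have l: "?l < d * d" and m: "?m < ?N" using div_bound[OF k] mod_bound[OF k] .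
  have "mat_vderiv r F X $ k = iter_partial (multi_index (d * d) r ?m) (entry ?l) (vectorize X)"
    using k m X by (simp add: D vderiv_scalar_def mult.commute)
  also have "\<dots> = (- 1) ^ r * (\<Sum>zs\<in>permutations_of_set {..<r}.
      chain_product d (F X) (map ((!) (multi_index (d * d) r ?m)) zs) (?l div d) (?l mod d))"
    using iter_partial_entry_nth[OF set_multi_index[OF m] l X] by simp
  also have "\<dots> = (- 1) ^ r * (fact r * ?R $ (?l * ?N + ?m))"
    by (simp only: symmetrized_commuted_kron_pow[OF Y l m])
  also have "\<dots> = (((- 1) ^ r * fact r) \<cdot>\<^sub>v ?R) $ k"
    using k \<open>dim_vec ?R = _\<close> by (simp add: mult.commute)
  finally show "mat_vderiv r F X $ k = (((- 1) ^ r * fact r) \<cdot>\<^sub>v ?R) $ k" .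
qed

end

theorem theorem8:
  fixes d r :: nat and F :: "real mat \<Rightarrow> real mat"
  assumes "r \<ge> 1"
    and "\<And>X. X \<in> carrier_mat d d \<Longrightarrow> invertible_mat X \<Longrightarrow>
           F X \<in> carrier_mat d d \<and> inverts_mat X (F X) \<and> inverts_mat (F X) X"
  shows "partially_differentiable_on r (\<lambda>x. vectorize (F (unvectorize d d x)))
           {vectorize X | X. X \<in> carrier_mat d d \<and> invertible_mat X} \<and>
         (\<forall>X \<in> carrier_mat d d. invertible_mat X \<longrightarrow>
           mat_vderiv r F X =
             ((- 1) ^ r * fact r) \<cdot>\<^sub>v
             ((kron_mat (1\<^sub>m (d ^ 2)) (symmetrizer (d ^ 2) r) *
               kron_mat (1\<^sub>m d) (comm_mat d (d ^ (2 * r)))) *\<^sub>v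
              kron_pow (vectorize (F X)) (r + 1)) \<and>
           mat_vderiv r F X \<in> carrier_vec (d ^ (2 * r + 2)))"
proof (intro conjI ballI impI)
  interpret matrix_inverse d F using assms(2) by unfold_locales
  show "partially_differentiable_on r (\<lambda>x. vectorize (F (unvectorize d d x)))
      {vectorize X | X. X \<in> carrier_mat d d \<and> invertible_mat X}"
    by (rule partially_differentiable_on_entry)
  fix X :: "real mat" assume X: "X \<in> carrier_mat d d" "invertible_mat X"
  show *: "mat_vderiv r F X = ((- 1) ^ r * fact r) \<cdot>\<^sub>v
      ((kron_mat (1\<^sub>m (d ^ 2)) (symmetrizer (d ^ 2) r) *
        kron_mat (1\<^sub>m d) (comm_mat d (d ^ (2 * r)))) *\<^sub>v kron_pow (vectorize (F X)) (r + 1))"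
    using mat_vderiv_eq[OF X] by (simp only: power2_eq_square power_mult)
  have "dim_row (symmetrizer (d ^ 2) r) = (d ^ 2) ^ r" using symmetrizer_carrier by auto
  then have "dim_vec (mat_vderiv r F X) = d ^ 2 * (d ^ 2) ^ r"
    unfolding * by (simp add: kron_mat_def)
  then show "mat_vderiv r F X \<in> carrier_vec (d ^ (2 * r + 2))"
    by (intro carrier_vecI) (simp add: power_add power_mult power2_eq_square)
qed

end
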